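(* Let $\mathcal{A}$ be a finite set of integral affinographic hyperplanes in $\mathbb{R}^n$ with integral gain graph $\Phi$, let $L_1,\dots,L_n$ be (possibly infinite) sets of nonnegative integers, let $m_1,\dots,m_n$ be integers and $P=[0,m_1]\times\cdots\times[0,m_n]$. Then the number of points in $P\cap(L_1\times\cdots\times L_n)$ not in any hyperplane of $\mathcal{A}$ equals $$\sum_{B\in\mathrm{Lat}^b\Phi}\mu(\emptyset,B)\prod_{B_k}\Big|\bigcap_{v_i\in V(B_k)}\big((L_i\cap[0,m_i])+\varphi(B_{v_it_k})\big)\Big|,$$ where the product is over all connected components $B_k$ of $(V,B)$, $V(B_k)$ is the vertex set of $B_k$, and $t_k$ is a top vertex of $B_k$.
   Context: An integral affinographic hyperplane is a hyperplane $x_j=x_i+a$ with $i\ne j$, $a\in\mathbb{Z}$. The integral gain graph $\Phi$ of $\mathcal{A}$ has vertex set $V=\{v_1,\dots,v_n\}$ and, for each hyperplane $x_j=x_i+a$ in $\mathcal{A}$, an edge from $v_i$ to $v_j$ with gain $a$ (gain $-a$ in the reverse direction); path gains are sums. An edge set is balanced if every circle in it has gain $0$, so all paths $B_{vw}$ from $v$ to $w$ in $B$ have the same gain $\varphi(B_{vw})$; a balanced $B$ is closed if it contains every edge $e$ lying in a balanced circle contained in $B\cup\{e\}$. $\mathrm{Lat}^b\Phi$ is the set of closed balanced edge sets ordered by inclusion, $\mu$ its Möbius function. A top vertex of a component of balanced $B$ is a vertex $t$ such that no path in that component ending at $t$ has negative gain. $X+g$ is the translate of $X\subseteq\mathbb{Z}$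 by $g$. *)

theory Defs
  imports "HOL-Analysis.Analysis"
begin

definition affinographic_hyperplane :: "'n::finite \<Rightarrow> 'n \<Rightarrow> int \<Rightarrow> (real ^ 'n) set" where
  "affinographic_hyperplane i j a = {x. x $ j = x $ i + of_int a}"

definition integral_affinographic :: "(real ^ 'n::finite) set \<Rightarrow> bool" where
  "integral_affinographic h \<longleftrightarrow> (\<exists>i j a. i \<noteq> j \<and> h = affinographic_hyperplane i j a)"

text \<open>
  A dart \<open>(v, e, g, w)\<close> is the edge \<open>e\<close> traversed from \<open>v\<close> to \<open>w\<close>, with gain \<open>g\<close> in that
  direction. The reverse traversal of the same edge is the dart \<open>(w, e, - g, v)\<close>.
\<close>

type_synonym ('v, 'e) dart = "'v \<times> 'e \<times> int \<times> 'v"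

fun dsource :: "('v, 'e) dart \<Rightarrow> 'v" where "dsource (v, e, g, w) = v"
fun dedge :: "('v, 'e) dart \<Rightarrow> 'e" where "dedge (v, e, g, w) = e"
fun dgain :: "('v, 'e) dart \<Rightarrow> int" where "dgain (v, e, g, w) = g"
fun dtarget :: "('v, 'e) dart \<Rightarrow> 'v" where "dtarget (v, e, g, w) = w"

record ('v, 'e) gain_graph =
  verts :: "'v set"
  edges :: "'e set"
  darts :: "('v, 'e) dart set"

text \<open>
  The edges are the hyperplanes themselves. Both directions of an edge are darts, because
  \<open>x\<^sub>j = x\<^sub>i + a\<close> and \<open>x\<^sub>i = x\<^sub>j + (- a)\<close> define the same set; the lemmas
  \<open>rev_dart\<close> and \<open>dart_unique\<close> below show that an edge has exactly these two darts.
\<close>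

definition affinographic_gain_graph ::
    "(real ^ 'n::finite) set set \<Rightarrow> ('n, (real ^ 'n) set) gain_graph" where
  "affinographic_gain_graph \<A> =
     \<lparr>verts = UNIV, edges = \<A>,
      darts = {(i, h, a, j). h \<in> \<A> \<and> i \<noteq> j \<and> h = affinographic_hyperplane i j a}\<rparr>"

fun walk :: "('v, 'e) gain_graph \<Rightarrow> 'e set \<Rightarrow> 'v \<Rightarrow> ('v, 'e) dart list \<Rightarrow> 'v \<Rightarrow> bool" where
  "walk \<Phi> B v [] w \<longleftrightarrow> v \<in> verts \<Phi> \<and> v = w"
| "walk \<Phi> B v (d # p) w \<longleftrightarrow>
     v \<in> verts \<Phi> \<and> d \<in> darts \<Phi> \<and> dedge d \<in> B \<and> dsource d = v \<and> walk \<Phi> B (dtarget d) p w"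

definition gain :: "('v, 'e) dart list \<Rightarrow> int" where
  "gain p = sum_list (map dgain p)"

definition gpath :: "('v, 'e) gain_graph \<Rightarrow> 'e set \<Rightarrow> 'v \<Rightarrow> ('v, 'e) dart list \<Rightarrow> 'v \<Rightarrow> bool" where
  "gpath \<Phi> B v p w \<longleftrightarrow> walk \<Phi> B v p w \<and> distinct (v # map dtarget p)"

text \<open>
  A circle is given by a traversal of it. Edges must be distinct so that going back and forth
  along one edge is not a circle of length 2, whereas two parallel edges do form one. The choice
  of starting vertex and direction changes the gain at most by sign.
\<close>

definition circle :: "('v, 'e) gain_graph \<Rightarrow> 'e set \<Rightarrow> ('v, 'e) dart list \<Rightarrow> bool" where
  "circle \<Phi> B p \<longleftrightarrow>
     p \<noteq> [] \<and> (\<exists>v. walk \<Phi> B v p v) \<and> distinct (map dtarget p) \<and> distinct (map dedge p)"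

definition balanced :: "('v, 'e) gain_graph \<Rightarrow> 'e set \<Rightarrow> bool" where
  "balanced \<Phi> B \<longleftrightarrow> (\<forall>p. circle \<Phi> B p \<longrightarrow> gain p = 0)"

definition closed_balanced :: "('v, 'e) gain_graph \<Rightarrow> 'e set \<Rightarrow> bool" where
  "closed_balanced \<Phi> B \<longleftrightarrow> B \<subseteq> edges \<Phi> \<and> balanced \<Phi> B \<and>
     (\<forall>e\<in>edges \<Phi>. (\<exists>p. circle \<Phi> (insert e B) p \<and> e \<in> set (map dedge p) \<and> gain p = 0) \<longrightarrow> e \<in> B)"

definition Lat_b :: "('v, 'e) gain_graph \<Rightarrow> 'e set set" where
  "Lat_b \<Phi> = {B. closed_balanced \<Phi> B}"

definition graph_components :: "('v, 'e) gain_graph \<Rightarrow> 'e set \<Rightarrow> 'v set set" where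
  "graph_components \<Phi> B = (\<lambda>v. {w. \<exists>p. gpath \<Phi> B v p w}) ` verts \<Phi>"

definition path_gain :: "('v, 'e) gain_graph \<Rightarrow> 'e set \<Rightarrow> 'v \<Rightarrow> 'v \<Rightarrow> int" where
  "path_gain \<Phi> B v w = (THE g. \<exists>p. gpath \<Phi> B v p w \<and> gain p = g)"

definition top_vertex :: "('v, 'e) gain_graph \<Rightarrow> 'e set \<Rightarrow> 'v set \<Rightarrow> 'v \<Rightarrow> bool" where
  "top_vertex \<Phi> B W t \<longleftrightarrow> t \<in> W \<and> (\<forall>v\<in>W. \<forall>p. gpath \<Phi> B v p t \<longrightarrow> 0 \<le> gain p)"

text \<open>
  The Moebius function of a family \<open>P\<close> of finite sets, ordered by inclusion, for
  arguments in \<open>P\<close>.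
\<close>

function poset_moebius :: "'a set set \<Rightarrow> 'a set \<Rightarrow> 'a set \<Rightarrow> int" where
  "poset_moebius P A B =
     (if A = B then 1
      else if A \<subset> B \<and> finite B then - (\<Sum>C\<in>{C\<in>P. A \<subseteq> C \<and> C \<subset> B}. poset_moebius P A C)
      else 0)"
  by pat_completeness auto
termination
  by (relation "Wellfounded.measure (\<lambda>(P, A, B). card B)") (auto intro: psubset_card_mono)

declare poset_moebius.simps [simp del]

definition translate :: "int set \<Rightarrow> int \<Rightarrow> int set" where
  "translate X g = (\<lambda>x. x + g) ` X"


subsection \<open>Path gains are well defined and top vertices exist\<close>

lemma affinographic_hyperplane_swap:
  "affinographic_hyperplane i j a = affinographic_hyperplane j i (- a)"
  by (auto simp: affinographic_hyperplane_def)

lemma rev_dart: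
  assumes "(i, h, a, j) \<in> darts (affinographic_gain_graph \<A>)"
  shows "(j, h, - a, i) \<in> darts (affinographic_gain_graph \<A>)"
  using assms affinographic_hyperplane_swap by (auto simp: affinographic_gain_graph_def)

lemma affinographic_hyperplane_eqD:
  assumes "i \<noteq> j" "k \<noteq> l" "affinographic_hyperplane i j a = affinographic_hyperplane k l b"
  shows "(k, l, b) = (i, j, a) \<or> (k, l, b) = (j, i, - a)"
proof -
  have *: "y \<in> affinographic_hyperplane k l b"
    if "y $ j = y $ i + of_int a" for y
    using that assms(3) by (auto simp: affinographic_hyperplane_def)
  let ?y = "\<lambda>c s. \<chi> r. if r = j then real_of_int a + s else if r = i then s else c (r::'a)"
  have key: "?y c s $ l = ?y c s $ k + of_int b" for c s
    using *[of "?y c s"] assms(1) by (auto simp: affinographic_hyperplane_def)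
  have k: "k = i \<or> k = j"
    using key[of 0 "\<lambda>_. 0"] key[of 0 "\<lambda>r. if r = k then 1 else 0"] assms(1,2)
    by (auto split: if_splits)
  have l: "l = i \<or> l = j"
    using key[of 0 "\<lambda>_. 0"] key[of 0 "\<lambda>r. if r = l then 1 else 0"] assms(1,2)
    by (auto split: if_splits)
  show ?thesis
    using key[of 0 "\<lambda>_. 0"] k l assms(1,2) by (auto simp flip: of_int_minus)
qed

lemma dart_unique:
  assumes "(i, h, a, j) \<in> darts (affinographic_gain_graph \<A>)"
    and "(k, h, b, l) \<in> darts (affinographic_gain_graph \<A>)"
  shows "(k, l, b) = (i, j, a) \<or> (k, l, b) = (j, i, - a)"
  using assms by (intro affinographic_hyperplane_eqD) (auto simp: affinographic_gain_graph_def)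

lemma verts_UNIV [simp]: "verts (affinographic_gain_graph \<A>) = UNIV"
  by (simp add: affinographic_gain_graph_def)

lemma gain_simps [simp]: "gain [] = 0" "gain (d # p) = dgain d + gain p"
    "gain (p @ q) = gain p + gain q"
  by (auto simp: gain_def)

lemma walk_append:
  "walk (affinographic_gain_graph \<A>) B v (p @ q) w \<longleftrightarrow>
     (\<exists>u. walk (affinographic_gain_graph \<A>) B v p u \<and> walk (affinographic_gain_graph \<A>) B u q w)"
  by (induction p arbitrary: v) auto

lemma walk_rev:
  assumes "walk (affinographic_gain_graph \<A>) B v p w"
  shows "\<exists>q. walk (affinographic_gain_graph \<A>) B w q v \<and> gain q = - gain p"
  using assms
proof (induction p arbitrary: v)
  case Nil
  then show ?case by (intro exI[of _ "[]"]) auto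
next
  case (Cons d p)
  obtain i h a j where d: "d = (i, h, a, j)" by (cases d)
  from Cons obtain q where "walk (affinographic_gain_graph \<A>) B w q j" "gain q = - gain p"
    by (auto simp: d)
  with Cons.prems rev_dart[of i h a j \<A>] show ?case
    by (intro exI[of _ "q @ [(j, h, - a, i)]"]) (auto simp: d walk_append)
qed

lemma not_distinct_map_decomp:
  assumes "\<not> distinct (map f p)"
  shows "\<exists>p1 d p2 d' p3. p = p1 @ [d] @ p2 @ [d'] @ p3 \<and> f d = f d'"
proof -
  from not_distinct_decomp[OF assms] obtain xs ys zs y
    where "map f p = xs @ [y] @ ys @ [y] @ zs" by blast
  then show ?thesis
    by (auto simp: map_eq_append_conv map_eq_Cons_conv append_eq_map_conv Cons_eq_map_conv) metis
qed

lemma balanced_closed_walk_gain: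
  assumes bal: "balanced (affinographic_gain_graph \<A>) B"
  shows "walk (affinographic_gain_graph \<A>) B v p v \<Longrightarrow> gain p = 0"
proof (induction "length p" arbitrary: p v rule: less_induct)
  case less
  let ?w = "walk (affinographic_gain_graph \<A>) B"
  consider "p = []" | "p \<noteq> []" "distinct (map dtarget p)" "distinct (map dedge p)"
    | "\<not> distinct (map dtarget p)" | "distinct (map dtarget p)" "\<not> distinct (map dedge p)"
    by blast
  then show ?case
  proof cases
    case 1
    then show ?thesis by simp
  next
    case 2
    then have "circle (affinographic_gain_graph \<A>) B p"
      using less.prems by (auto simp: circle_def)
    then show ?thesis using bal by (simp add: balanced_def)
  next
    case 3
    then obtain p1 d p2 d' p3 where p: "p = p1 @ [d] @ p2 @ [d'] @ p3" and dd: "dtarget d = dtarget d'"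
      using not_distinct_map_decomp by blast
    have 1: "?w (dtarget d) (p2 @ [d']) (dtarget d)" and 2: "?w v (p1 @ [d] @ p3) v"
      using less.prems dd by (auto simp: p walk_append)
    have "gain (p2 @ [d']) = 0" by (rule less.hyps[OF _ 1]) (simp add: p)
    moreover have "gain (p1 @ [d] @ p3) = 0" by (rule less.hyps[OF _ 2]) (simp add: p)
    ultimately show ?thesis by (simp add: p)
  next
    case 4
    then obtain p1 d p2 d' p3 where p: "p = p1 @ [d] @ p2 @ [d'] @ p3" and dd: "dedge d = dedge d'"
      using not_distinct_map_decomp by blast
    obtain i h a j where d: "d = (i, h, a, j)" by (cases d)
    obtain k b l where d': "d' = (k, h, b, l)" using dd d by (cases d') auto
    have "(k, l, b) = (i, j, a) \<or> (k, l, b) = (j, i, - a)"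
      using less.prems by (intro dart_unique[of i h a j \<A>]) (auto simp: p d d' walk_append)
    then have kl: "k = j" "l = i" "b = - a" using 4 by (auto simp: p d d')
    have 1: "?w j p2 j" and 2: "?w v (p1 @ p3) v"
      using less.prems by (auto simp: p d d' kl walk_append)
    have "gain p2 = 0" by (rule less.hyps[OF _ 1]) (simp add: p)
    moreover have "gain (p1 @ p3) = 0" by (rule less.hyps[OF _ 2]) (simp add: p)
    ultimately show ?thesis by (simp add: p d d' kl)
  qed
qed

lemma balanced_walk_gain_unique:
  assumes "balanced (affinographic_gain_graph \<A>) B"
    and "walk (affinographic_gain_graph \<A>) B v p w" "walk (affinographic_gain_graph \<A>) B v q w"
  shows "gain p = gain q"
proof -
  obtain r where "walk (affinographic_gain_graph \<A>) B w r v" "gain r = - gain q"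
    using walk_rev assms(3) by blast
  then show ?thesis
    using balanced_closed_walk_gain[OF assms(1), of v "p @ r"] assms(2) by (auto simp: walk_append)
qed

lemma path_gain_eq:
  assumes "balanced (affinographic_gain_graph \<A>) B" "gpath (affinographic_gain_graph \<A>) B v p w"
  shows "path_gain (affinographic_gain_graph \<A>) B v w = gain p"
  unfolding path_gain_def
  by (rule the_equality) (use assms balanced_walk_gain_unique in \<open>auto simp: gpath_def\<close>)

lemma top_vertex_exists:
  assumes bal: "balanced (affinographic_gain_graph \<A>) B"
    and W: "W \<in> graph_components (affinographic_gain_graph \<A>) B"
  shows "\<exists>t. top_vertex (affinographic_gain_graph \<A>) B W t"
proof -
  let ?\<Phi> = "affinographic_gain_graph \<A>"
  obtain v where v: "W = {w. \<exists>p. gpath ?\<Phi> B v p w}" using W by (auto simp: graph_components_def)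
  have "v \<in> W" by (auto simp: v gpath_def intro: exI[of _ "[]"])
  define f where "f = path_gain ?\<Phi> B v"
  have "finite W" "W \<noteq> {}" using \<open>v \<in> W\<close> by auto
  then have "\<exists>t\<in>W. f t = Max (f ` W)" using Max_in[of "f ` W"] by (metis (no_types, lifting) finite_imageI imageE image_is_empty)
  then obtain t where t: "t \<in> W" "f t = Max (f ` W)" by blast
  have max: "f u \<le> f t" if "u \<in> W" for u using that t(2) \<open>finite W\<close> by simp
  have "0 \<le> gain p" if u: "u \<in> W" and p: "gpath ?\<Phi> B u p t" for u p
  proof -
    obtain q where q: "gpath ?\<Phi> B v q u" using u v by blast
    obtain r where r: "gpath ?\<Phi> B v r t" using t v by blast
    have "walk ?\<Phi> B v (q @ p) t" using p q by (auto simp: gpath_def walk_append)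
    then have "gain (q @ p) = gain r"
      using balanced_walk_gain_unique[OF bal] r by (auto simp: gpath_def)
    with max[OF u] show ?thesis using path_gain_eq[OF bal] q r by (simp add: f_def)
  qed
  with t show ?thesis by (auto simp: top_vertex_def)
qed

end

theory Submission
  imports Defs
begin

text \<open>
  The set \<open>\<A>(x)\<close> of hyperplanes through a point \<open>x\<close> is a closed balanced edge set, because
  a walk from \<open>v\<close> to \<open>w\<close> inside it has gain \<open>x\<^sub>w - x\<^sub>v\<close>. By the defining recursion of the
  Moebius function, the sum of \<open>\<mu>(\<emptyset>, B)\<close> over all closed balanced \<open>B \<subseteq> \<A>(x)\<close> is 1 if
  \<open>\<A>(x) = \<emptyset>\<close> and 0 otherwise. Summing over the admissible points \<open>x\<close> and exchanging the
  sums, \<open>\<mu>(\<emptyset>, B)\<close> is multiplied by the number of admissible points on all hyperplanes of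
  \<open>B\<close>. Such a point is determined by its coordinates at one chosen vertex of each component, and
  these coordinates vary independently over the intersections of translates.
\<close>

section \<open>Moebius sums over intervals\<close>

text \<open>The recursion defines the value at \<open>C\<close> as minus the sum over the strictly
  smaller members, and \<open>C\<close> is the only other member in the range of summation, so
  everything cancels unless \<open>A = C\<close>.\<close>

lemma sum_poset_moebius:
  assumes "C \<in> P" "finite C" "A \<subseteq> C"
  shows "(\<Sum>B\<in>{B\<in>P. A \<subseteq> B \<and> B \<subseteq> C}. poset_moebius P A B) = (if A = C then 1 else 0)"
proof (cases "A = C")
  case True
  then have "{B\<in>P. A \<subseteq> B \<and> B \<subseteq> C} = {C}" using assms by auto
  then show ?thesis using True by (simp add: poset_moebius.simps)
next
  case False
  have eq: "{B\<in>P. A \<subseteq> B \<and> B \<subseteq> C} = insert C {B\<in>P. A \<subseteq> B \<and> B \<subset> C}"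
    using assms by auto
  have fin: "finite {B\<in>P. A \<subseteq> B \<and> B \<subset> C}"
    by (rule finite_subset[of _ "Pow C"]) (use assms in auto)
  have "A \<subset> C" using False assms by auto
  then have "poset_moebius P A C = - (\<Sum>B\<in>{B\<in>P. A \<subseteq> B \<and> B \<subset> C}. poset_moebius P A B)"
    using assms by (subst poset_moebius.simps) auto
  then show ?thesis using False fin by (simp add: eq)
qed

section \<open>Integer points and the hyperplanes through them\<close>

definition int_point :: "('n::finite \<Rightarrow> int) \<Rightarrow> real ^ 'n" where
  "int_point y = (\<chi> i. real_of_int (y i))"

lemma inj_int_point: "inj int_point"
  by (auto simp: int_point_def inj_on_def vec_eq_iff)

lemma int_point_in_hyperplane_iff:
  "int_point y \<in> affinographic_hyperplane i j a \<longleftrightarrow> y j = y i + a"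
  by (simp add: int_point_def affinographic_hyperplane_def flip: of_int_add)

text \<open>Moves the count from real vectors to integer-valued functions. If some
  \<open>m i\<close> is negative, both sides are empty.\<close>

lemma box_lattice_points_eq:
  fixes m :: "'n::finite \<Rightarrow> int" and L :: "'n \<Rightarrow> int set"
  shows "cbox 0 (\<chi> i. real_of_int (m i)) \<inter> {x. \<forall>i. x $ i \<in> real_of_int ` L i} =
     int_point ` (\<Pi>\<^sub>E i\<in>UNIV. L i \<inter> {0..m i})"
proof (intro equalityI subsetI)
  fix x :: "real ^ 'n"
  assume x: "x \<in> cbox 0 (\<chi> i. real_of_int (m i)) \<inter> {x. \<forall>i. x $ i \<in> real_of_int ` L i}"
  then have "\<forall>i. \<exists>k. k \<in> L i \<and> x $ i = real_of_int k" by blast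
  then obtain y where y: "\<And>i. y i \<in> L i" "\<And>i. x $ i = real_of_int (y i)"
    by metis
  then have "x = int_point y" by (simp add: int_point_def vec_eq_iff)
  moreover have "y \<in> (\<Pi>\<^sub>E i\<in>UNIV. L i \<inter> {0..m i})"
    using x y by (auto simp: mem_box_cart)
  ultimately show "x \<in> int_point ` (\<Pi>\<^sub>E i\<in>UNIV. L i \<inter> {0..m i})" by blast
qed (auto simp: int_point_def mem_box_cart PiE_iff)

text \<open>The coordinates of \<open>y\<close> act as a potential: the equation of each traversed
  hyperplane says that the coordinate grows by the gain of the dart, and the differences
  telescope.\<close>

lemma int_point_walk_gain:
  assumes "walk (affinographic_gain_graph \<A>) B v p w" "\<And>h. h \<in> B \<Longrightarrow> int_point y \<in> h"
  shows "y w = y v + gain p"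
  using assms(1)
proof (induction p arbitrary: v)
  case (Cons d p)
  obtain i h a j where d: "d = (i, h, a, j)" by (cases d)
  have "int_point y \<in> h" "h = affinographic_hyperplane i j a"
    using Cons.prems assms(2) by (auto simp: d affinographic_gain_graph_def)
  then have "y j = y i + a" by (simp add: int_point_in_hyperplane_iff)
  then show ?case using Cons by (auto simp: d)
qed simp

lemma walk_avoiding_edge:
  assumes "walk \<Phi> (insert e B) v p w" "e \<notin> set (map dedge p)"
  shows "walk \<Phi> B v p w"
  using assms by (induction p arbitrary: v) auto

lemma hyperplanes_through_point_closed_balanced:
  "{h\<in>\<A>. int_point y \<in> h} \<in> Lat_b (affinographic_gain_graph \<A>)"
proof -
  let ?\<Phi> = "affinographic_gain_graph \<A>" and ?B = "{h\<in>\<A>. int_point y \<in> h}"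
  have "gain p = 0" if "circle ?\<Phi> ?B p" for p
    using that int_point_walk_gain[of \<A> ?B _ p _ y] by (fastforce simp: circle_def)
  moreover have "int_point y \<in> e"
    if p: "circle ?\<Phi> (insert e ?B) p" "e \<in> set (map dedge p)" "gain p = 0" for e p
  proof -
    obtain d where d: "d \<in> set p" "dedge d = e" using p(2) by auto
    then obtain p1 p2 where p12: "p = p1 @ d # p2" by (meson split_list)
    obtain i a j where dd: "d = (i, e, a, j)" using d(2) by (cases d) auto
    obtain v where "walk ?\<Phi> (insert e ?B) v p v" using p(1) by (auto simp: circle_def)
    then have w: "walk ?\<Phi> (insert e ?B) v p1 i" "walk ?\<Phi> (insert e ?B) j p2 v"
      and "d \<in> darts ?\<Phi>"
      by (auto simp: p12 dd walk_append)
    then have h: "e = affinographic_hyperplane i j a"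
      by (simp add: dd affinographic_gain_graph_def)
    \<comment> \<open>A circle uses each edge once, so what remains of it after removing
      \<open>d\<close> runs through hyperplanes already known to contain the point.\<close>
    have "e \<notin> set (map dedge p1)" "e \<notin> set (map dedge p2)"
      using p(1) by (auto simp: circle_def p12 dd)
    then have "y i = y v + gain p1" "y v = y j + gain p2"
      using w by (auto dest!: walk_avoiding_edge intro!: int_point_walk_gain)
    \<comment> \<open>The gains \<open>gain p1\<close>, \<open>a\<close> and \<open>gain p2\<close>
      sum to 0, so eliminating \<open>y v\<close> from the two equations leaves the equation of
      \<open>e\<close>.\<close>
    then have "y j = y i + a" using p(3) by (simp add: p12 dd)
    then show ?thesis by (simp add: h int_point_in_hyperplane_iff)
  qed
  ultimately show ?thesis
    by (auto simp: Lat_b_def closed_balanced_def balanced_def affinographic_gain_graph_def)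
qed

section \<open>Walks, components and path gains\<close>

text \<open>Cutting out the closed segment between two visits to a vertex shortens the walk. Thus
  components, defined by paths, can be handled with walks, which concatenate freely.\<close>

lemma walk_imp_gpath:
  assumes "walk (affinographic_gain_graph \<A>) B v p w"
  shows "\<exists>q. gpath (affinographic_gain_graph \<A>) B v q w"
  using assms
proof (induction "length p" arbitrary: p rule: less_induct)
  case less
  let ?w = "walk (affinographic_gain_graph \<A>) B"
  consider "distinct (v # map dtarget p)" | "v \<in> set (map dtarget p)"
    | "\<not> distinct (map dtarget p)" by auto
  then show ?case
  proof cases
    case 1
    then show ?thesis using less.prems by (auto simp: gpath_def)
  next
    case 2
    then obtain d where "d \<in> set p" "dtarget d = v" by auto
    then obtain p1 p2 where p: "p = p1 @ d # p2" by (meson split_list)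
    then have "?w v p2 w" using less.prems \<open>dtarget d = v\<close> by (auto simp: walk_append)
    then show ?thesis using less.hyps[of p2] by (simp add: p)
  next
    case 3
    then obtain p1 d p2 d' p3
      where p: "p = p1 @ [d] @ p2 @ [d'] @ p3" and "dtarget d = dtarget d'"
      using not_distinct_map_decomp by blast
    then have "?w v (p1 @ [d] @ p3) w" using less.prems by (auto simp: walk_append)
    then show ?thesis using less.hyps[of "p1 @ [d] @ p3"] by (simp add: p)
  qed
qed

definition component_of :: "('v, 'e) gain_graph \<Rightarrow> 'e set \<Rightarrow> 'v \<Rightarrow> 'v set" where
  "component_of \<Phi> B v = {w. \<exists>p. gpath \<Phi> B v p w}"

lemma component_of_iff_walk:
  "w \<in> component_of (affinographic_gain_graph \<A>) B v \<longleftrightarrow>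
     (\<exists>p. walk (affinographic_gain_graph \<A>) B v p w)"
  using walk_imp_gpath by (fastforce simp: component_of_def gpath_def)

text \<open>Walks can be reversed and concatenated, so reachability is an equivalence
  relation.\<close>

lemma component_of_eqI:
  assumes "walk (affinographic_gain_graph \<A>) B v p w"
  shows "component_of (affinographic_gain_graph \<A>) B v =
    component_of (affinographic_gain_graph \<A>) B w"
proof -
  obtain q where "walk (affinographic_gain_graph \<A>) B w q v"
    using walk_rev[OF assms] by blast
  then show ?thesis
    using assms by (auto simp: set_eq_iff component_of_iff_walk) (meson walk_append)+
qed

lemma graph_components_eq:
  "graph_components (affinographic_gain_graph \<A>) B =
     range (component_of (affinographic_gain_graph \<A>) B)"
  by (simp add: graph_components_def component_of_def)

lemma self_in_component_of: "v \<in> component_of (affinographic_gain_graph \<A>) B v"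
  by (auto simp: component_of_iff_walk intro: exI[of _ "[]"])

lemma component_eq_component_of:
  assumes "W \<in> graph_components (affinographic_gain_graph \<A>) B" "v \<in> W"
  shows "W = component_of (affinographic_gain_graph \<A>) B v"
proof -
  obtain u where u: "W = component_of (affinographic_gain_graph \<A>) B u"
    using assms(1) by (auto simp: graph_components_eq)
  then obtain p where "walk (affinographic_gain_graph \<A>) B u p v"
    using assms(2) by (auto simp: component_of_iff_walk)
  then show ?thesis unfolding u by (rule component_of_eqI)
qed

text \<open>Balance gives all walks between two vertices the same gain, so the value defined through
  paths can be read off any walk.\<close>

lemma path_gain_eq_walk_gain:
  assumes "balanced (affinographic_gain_graph \<A>) B" "walk (affinographic_gain_graph \<A>) B v p w"
  shows "path_gain (affinographic_gain_graph \<A>) B v w = gain p"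
proof -
  obtain q where q: "gpath (affinographic_gain_graph \<A>) B v q w"
    using walk_imp_gpath assms(2) by blast
  then show ?thesis
    using path_gain_eq[OF assms(1) q] balanced_walk_gain_unique[OF assms(1,2), of q]
    by (auto simp: gpath_def)
qed

lemma mem_translate_iff: "x \<in> translate X g \<longleftrightarrow> x - g \<in> X"
  by (force simp: translate_def)

section \<open>Counting the points on a balanced edge set\<close>

text \<open>A point on all hyperplanes in \<open>B\<close> is determined by its values at the
  vertices \<open>t W\<close>. Membership of \<open>y i\<close> in \<open>X i\<close> becomes
  membership of \<open>y (t W)\<close> in a translate of \<open>X i\<close>, and distinct components
  impose no joint condition.\<close>

lemma card_int_points_on_balanced:
  fixes \<A> :: "(real ^ 'n::finite) set set" and X :: "'n \<Rightarrow> int set" and t :: "'n set \<Rightarrow> 'n"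
  defines "\<Phi> \<equiv> affinographic_gain_graph \<A>"
  assumes bal: "balanced \<Phi> B" and sub: "B \<subseteq> \<A>"
    and aff: "\<And>h. h \<in> B \<Longrightarrow> integral_affinographic h"
    and t: "\<And>W. W \<in> graph_components \<Phi> B \<Longrightarrow> t W \<in> W"
  shows "card {y\<in>(\<Pi>\<^sub>E i\<in>UNIV. X i). \<forall>h\<in>B. int_point y \<in> h} =
    (\<Prod>W\<in>graph_components \<Phi> B. card (\<Inter>i\<in>W. translate (X i) (path_gain \<Phi> B i (t W))))"
proof -
  let ?S = "{y\<in>(\<Pi>\<^sub>E i\<in>UNIV. X i). \<forall>h\<in>B. int_point y \<in> h}"
  let ?C = "graph_components \<Phi> B"
  let ?T = "\<Pi>\<^sub>E W\<in>?C. \<Inter>i\<in>W. translate (X i) (path_gain \<Phi> B i (t W))"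
  let ?c = "component_of \<Phi> B"
  \<comment> \<open>\<open>?f\<close> records the values at the chosen vertices; its inverse
    \<open>?g\<close> recovers coordinate \<open>i\<close> by subtracting the gain from
    \<open>i\<close> to the chosen vertex of its component.\<close>
  let ?f = "\<lambda>y. \<lambda>W\<in>?C. y (t W)"
  let ?g = "\<lambda>z i. z (?c i) - path_gain \<Phi> B i (t (?c i))"
  have comp: "?c i \<in> ?C" for i by (simp add: graph_components_eq \<Phi>_def)
  have walk_top: "\<exists>p. walk \<Phi> B i p (t W)" if "W \<in> ?C" "i \<in> W" for i W
    using t[OF that(1)] component_eq_component_of[of W \<A> B i] that
      component_of_iff_walk[of "t W" \<A> B i] by (simp add: \<Phi>_def)
  have val: "y (t W) = y i + path_gain \<Phi> B i (t W)" if "y \<in> ?S" "W \<in> ?C" "i \<in> W" for y W i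
  proof -
    obtain p where p: "walk \<Phi> B i p (t W)" using walk_top \<open>W \<in> ?C\<close> \<open>i \<in> W\<close> by blast
    then have "y (t W) = y i + gain p"
      using that unfolding \<Phi>_def by (intro int_point_walk_gain) auto
    then show ?thesis using path_gain_eq_walk_gain[of \<A> B] bal p by (simp add: \<Phi>_def)
  qed
  have in_comp: "i \<in> ?c i" for i by (simp add: self_in_component_of \<Phi>_def)
  have "bij_betw ?f ?S ?T"
  proof (rule bij_betw_byWitness[where f' = ?g])
    show "\<forall>y\<in>?S. ?g (?f y) = y"
    proof (intro ballI ext)
      fix y i assume "y \<in> ?S"
      from val[OF this comp in_comp, of i] show "?g (?f y) i = y i" using comp by simp
    qed
    show "\<forall>z\<in>?T. ?f (?g z) = z"
    proof
      fix z assume z: "z \<in> ?T"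
      have "?g z (t W) = z W" if W: "W \<in> ?C" for W
      proof -
        \<comment> \<open>The empty walk at \<open>t W\<close> has gain 0, so \<open>?g\<close> puts
          the prescribed value \<open>z W\<close> at \<open>t W\<close>.\<close>
        have "?c (t W) = W" using component_eq_component_of[of W \<A> B "t W"] t[OF W] W by (simp add: \<Phi>_def)
        moreover have "path_gain \<Phi> B (t W) (t W) = 0"
          using path_gain_eq_walk_gain[of \<A> B "t W" "[]" "t W"] bal by (simp add: \<Phi>_def)
        ultimately show ?thesis by simp
      qed
      then show "?f (?g z) = z" using z by (auto simp: fun_eq_iff PiE_iff extensional_def)
    qed
    show "?f ` ?S \<subseteq> ?T"
    proof
      fix z assume "z \<in> ?f ` ?S"
      then obtain y where y: "y \<in> ?S" "z = ?f y" by blast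
      have "y (t W) \<in> translate (X i) (path_gain \<Phi> B i (t W))" if "W \<in> ?C" "i \<in> W" for W i
        using val[OF y(1) that] y(1) by (auto simp: mem_translate_iff)
      then show "z \<in> ?T" by (auto simp: y(2))
    qed
    show "?g ` ?T \<subseteq> ?S"
    proof
      fix y assume "y \<in> ?g ` ?T"
      then obtain z where z: "z \<in> ?T" "y = ?g z" by blast
      have "y i \<in> X i" for i
      proof -
        have "z (?c i) \<in> (\<Inter>j\<in>?c i. translate (X j) (path_gain \<Phi> B j (t (?c i))))"
          using PiE_mem[OF z(1) comp] .
        then show ?thesis using in_comp by (auto simp: z(2) mem_translate_iff)
      qed
      moreover have "int_point y \<in> h" if h: "h \<in> B" for h
      proof -
        obtain i j a where ija: "i \<noteq> j" "h = affinographic_hyperplane i j a"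
          using aff[OF h] by (auto simp: integral_affinographic_def)
        have d: "(i, h, a, j) \<in> darts \<Phi>"
          using ija h sub by (auto simp: \<Phi>_def affinographic_gain_graph_def)
        have "walk \<Phi> B i [(i, h, a, j)] j" using d h by (simp add: \<Phi>_def)
        then have c: "?c i = ?c j" unfolding \<Phi>_def by (rule component_of_eqI)
        obtain p where p: "walk \<Phi> B j p (t (?c j))" using walk_top[OF comp in_comp] by blast
        then have q: "walk \<Phi> B i ((i, h, a, j) # p) (t (?c j))" using d h by (simp add: \<Phi>_def)
        \<comment> \<open>Prefixing the dart of \<open>h\<close> to a walk from \<open>j\<close>
          gives a walk from \<open>i\<close> to the same end. The two path gains hence differ by
          \<open>a\<close>, which is the equation of \<open>h\<close> for
          \<open>?g z\<close>.\<close>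
        have "path_gain \<Phi> B i (t (?c j)) = a + path_gain \<Phi> B j (t (?c j))"
          using path_gain_eq_walk_gain[OF bal[unfolded \<Phi>_def] p[unfolded \<Phi>_def]]
            path_gain_eq_walk_gain[OF bal[unfolded \<Phi>_def] q[unfolded \<Phi>_def]]
          by (simp add: \<Phi>_def)
        then show ?thesis by (simp add: ija(2) int_point_in_hyperplane_iff z(2) c)
      qed
      ultimately show "y \<in> ?S" by auto
    qed
  qed
  then have "card ?S = card ?T" by (rule bij_betw_same_card)
  then show ?thesis by (simp add: card_PiE)
qed

section \<open>Summing the Moebius function over the points of the box\<close>

theorem theorem5p21:
  fixes \<A> :: "(real ^ 'n::finite) set set"
    and \<Phi> :: "('n, (real ^ 'n) set) gain_graph"
    and L :: "'n \<Rightarrow> int set"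
    and m :: "'n \<Rightarrow> int"
    and t :: "(real ^ 'n) set set \<Rightarrow> 'n set \<Rightarrow> 'n"
  assumes "\<Phi> = affinographic_gain_graph \<A>"
    and "finite \<A>"
    and "\<And>h. h \<in> \<A> \<Longrightarrow> integral_affinographic h"
    and "\<And>i. L i \<subseteq> {0..}"
    and "\<And>B W. B \<in> Lat_b \<Phi> \<Longrightarrow> W \<in> graph_components \<Phi> B \<Longrightarrow> top_vertex \<Phi> B W (t B W)"
  shows "int (card (cbox 0 (\<chi> i. real_of_int (m i)) \<inter> {x. \<forall>i. x $ i \<in> real_of_int ` L i} - \<Union>\<A>)) =
    (\<Sum>B\<in>Lat_b \<Phi>. poset_moebius (Lat_b \<Phi>) {} B *
      (\<Prod>W\<in>graph_components \<Phi> B.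
         int (card (\<Inter>i\<in>W. translate (L i \<inter> {0..m i}) (path_gain \<Phi> B i (t B W))))))"
proof -
  let ?X = "\<lambda>i. L i \<inter> {0..m i}"
  let ?Y = "\<Pi>\<^sub>E i\<in>UNIV. ?X i"
  let ?\<mu> = "poset_moebius (Lat_b \<Phi>) {}"
  let ?A = "\<lambda>y. {h\<in>\<A>. int_point y \<in> h}"
  \<comment> \<open>Each \<open>L i\<close> may be infinite; the bounds \<open>{0..m i}\<close> make
    the product finite.\<close>
  have finY: "finite ?Y" by (intro finite_PiE) auto
  have sub: "B \<subseteq> \<A>" if "B \<in> Lat_b \<Phi>" for B
    using that by (simp add: assms(1) Lat_b_def closed_balanced_def affinographic_gain_graph_def)
  then have "Lat_b \<Phi> \<subseteq> Pow \<A>" by blast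
  then have finLat: "finite (Lat_b \<Phi>)" by (rule finite_subset) (simp add: assms(2))
  have count: "(\<Prod>W\<in>graph_components \<Phi> B.
         int (card (\<Inter>i\<in>W. translate (?X i) (path_gain \<Phi> B i (t B W))))) =
      int (card {y\<in>?Y. B \<subseteq> ?A y})" if B: "B \<in> Lat_b \<Phi>" for B
  proof -
    have "{y\<in>?Y. B \<subseteq> ?A y} = {y\<in>?Y. \<forall>h\<in>B. int_point y \<in> h}" using sub[OF B] by blast
    moreover have "card {y\<in>?Y. \<forall>h\<in>B. int_point y \<in> h} = (\<Prod>W\<in>graph_components \<Phi> B.
        card (\<Inter>i\<in>W. translate (?X i) (path_gain \<Phi> B i (t B W))))"
      unfolding assms(1)
    proof (rule card_int_points_on_balanced)
      show "balanced (affinographic_gain_graph \<A>) B"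
        using B by (simp add: assms(1) Lat_b_def closed_balanced_def)
      show "t B W \<in> W" if "W \<in> graph_components (affinographic_gain_graph \<A>) B" for W
        using assms(5)[OF B] that by (simp add: assms(1) top_vertex_def)
    qed (use sub[OF B] assms(3) in blast)+
    ultimately show ?thesis by simp
  qed
  \<comment> \<open>This sum is the indicator of the points that avoid all of \<open>\<A>\<close>,
    written over \<open>Lat_b \<Phi>\<close> because \<open>?A y\<close> is itself a member.\<close>
  have moebius: "(\<Sum>B\<in>{B\<in>Lat_b \<Phi>. B \<subseteq> ?A y}. ?\<mu> B) = (if ?A y = {} then 1 else 0)" for y
  proof -
    have "?A y \<in> Lat_b \<Phi>" unfolding assms(1) by (rule hyperplanes_through_point_closed_balanced)
    from sum_poset_moebius[OF this, of "{}"] show ?thesis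
      using assms(2) by (simp add: eq_commute[of "{}"])
  qed
  have "cbox 0 (\<chi> i. real_of_int (m i)) \<inter> {x. \<forall>i. x $ i \<in> real_of_int ` L i} - \<Union>\<A> =
      int_point ` {y\<in>?Y. ?A y = {}}"
    unfolding box_lattice_points_eq by auto
  then have "int (card (cbox 0 (\<chi> i. real_of_int (m i)) \<inter> {x. \<forall>i. x $ i \<in> real_of_int ` L i} - \<Union>\<A>)) =
      int (card {y\<in>?Y. ?A y = {}})"
    by (simp only: card_image[OF inj_on_subset[OF inj_int_point subset_UNIV]])
  also have "\<dots> = (\<Sum>y\<in>?Y. if ?A y = {} then 1 else 0)"
    using finY by (simp add: sum.If_cases Int_def)
  also have "\<dots> = (\<Sum>y\<in>?Y. \<Sum>B\<in>{B\<in>Lat_b \<Phi>. B \<subseteq> ?A y}. ?\<mu> B)"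
    by (simp only: moebius)
  \<comment> \<open>Both double sums run over the pairs of \<open>y\<close> and \<open>B\<close>
    with \<open>B \<subseteq> ?A y\<close>. For fixed \<open>B\<close> the inner summand is
    constant, so the inner sum becomes a cardinality.\<close>
  also have "\<dots> = (\<Sum>B\<in>Lat_b \<Phi>. \<Sum>y\<in>{y\<in>?Y. B \<subseteq> ?A y}. ?\<mu> B)"
    by (rule sum.swap_restrict[OF finY finLat])
  also have "\<dots> = (\<Sum>B\<in>Lat_b \<Phi>. ?\<mu> B * int (card {y\<in>?Y. B \<subseteq> ?A y}))"
    by (simp add: mult.commute)
  finally show ?thesis using count by simp
qed

end
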